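(* Let $\alpha=(\alpha_1,\dots,\alpha_m)$ be a ribbon with $m\ge 3$ and $\alpha_k\ge 2$ for all $k$, and set $\alpha_0=\infty$. Suppose that for some $1\le i\le m-1$ we have $\alpha_i>\alpha_{i+1}$ and $\alpha_i<\alpha_{i-1}+\alpha_{i+1}$. Then $[\alpha]\subseteq[\alpha_{(i\ i+1)}]$.
   Context: A composition $\alpha=(\alpha_1,\dots,\alpha_m)$ determines the ribbon (connected skew shape with no $2\times2$ block) with $m$ rows whose $i$-th row from the top has $\alpha_i$ boxes, the leftmost box of row $i$ lying directly above the rightmost box of row $i+1$. $\alpha_{(i\ i+1)}$ denotes the ribbon whose row-length sequence is $\alpha$ with the $i$-th and $(i+1)$-st entries swapped. For a skew shape $\lambda/\mu$ with Schur expansion $s_{\lambda/\mu}=\sum_\nu c^\lambda_{\mu,\nu}s_\nu$, the Schur support is $[\lambda/\mu]=\{\nu: c^\lambda_{\mu,\nu}>0\}$; by the Littlewood–Richardson rule, $\nu\in[\lambda/\mu]$ iff there is a tableau of shape $\lambda/\mu$ and content $\nu$ that is semistandard (rows weakly increasing, columns strictly increasing) and whose reverse reading word (rows read right to left, top to bottom) is Yamanouchi (every prefix has at least as many $k$'s as $(k+1)$'s for all $k$). *)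

theory Defs
  imports Main
begin

definition is_partition :: "nat list \<Rightarrow> bool" where
  "is_partition nu \<longleftrightarrow> sorted_wrt (\<ge>) nu \<and> 0 \<notin> set nu"

text \<open>Skew shapes lambda/mu, given by row-length lists (rows indexed from 0, top row 0,
  English convention; cells are (row, column), columns indexed from 0).
  A missing entry of mu counts as 0.\<close>
definition part_at :: "nat list \<Rightarrow> nat \<Rightarrow> nat" where
  "part_at mu r = (if r < length mu then mu ! r else 0)"

definition skew_cells :: "nat list \<Rightarrow> nat list \<Rightarrow> (nat \<times> nat) set" where
  "skew_cells la mu = {(r, c). r < length la \<and> part_at mu r \<le> c \<and> c < la ! r}"

definition semistandard :: "nat list \<Rightarrow> nat list \<Rightarrow> (nat \<times> nat \<Rightarrow> nat) \<Rightarrow> bool" where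
  "semistandard la mu T \<longleftrightarrow>
     (\<forall>r c c'. (r, c) \<in> skew_cells la mu \<longrightarrow> (r, c') \<in> skew_cells la mu \<longrightarrow> c < c' \<longrightarrow> T (r, c) \<le> T (r, c')) \<and>
     (\<forall>r r' c. (r, c) \<in> skew_cells la mu \<longrightarrow> (r', c) \<in> skew_cells la mu \<longrightarrow> r < r' \<longrightarrow> T (r, c) < T (r', c))"

definition reverse_reading_word :: "nat list \<Rightarrow> nat list \<Rightarrow> (nat \<times> nat \<Rightarrow> nat) \<Rightarrow> nat list" where
  "reverse_reading_word la mu T =
     concat (map (\<lambda>r. map (\<lambda>c. T (r, c)) (rev [part_at mu r ..< la ! r])) [0 ..< length la])"

definition yamanouchi :: "nat list \<Rightarrow> bool" where
  "yamanouchi w \<longleftrightarrow>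
     (\<forall>n \<le> length w. \<forall>k \<ge> 1. count_list (take n w) (Suc k) \<le> count_list (take n w) k)"

definition lr_tableau :: "nat list \<Rightarrow> nat list \<Rightarrow> nat list \<Rightarrow> (nat \<times> nat \<Rightarrow> nat) \<Rightarrow> bool" where
  "lr_tableau la mu nu T \<longleftrightarrow>
     (\<forall>x \<in> skew_cells la mu. 1 \<le> T x \<and> T x \<le> length nu) \<and>
     (\<forall>k < length nu. card {x \<in> skew_cells la mu. T x = Suc k} = nu ! k) \<and>
     semistandard la mu T \<and>
     yamanouchi (reverse_reading_word la mu T)"

text \<open>Schur support [lambda/mu], via the Littlewood-Richardson rule.\<close>
definition schur_support :: "nat list \<Rightarrow> nat list \<Rightarrow> nat list set" where
  "schur_support la mu = {nu. is_partition nu \<and> (\<exists>T. lr_tableau la mu nu T)}"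

text \<open>Ribbon of a composition alpha (list, alpha!0 = top row).  Row i (0-indexed) occupies
  columns from s_i = sum_{j>i} alpha_j - (m-1-i) to s_i + alpha_i - 1, so that the leftmost box
  of row i lies directly above the rightmost box of row i+1.\<close>
definition ribbon_outer :: "nat list \<Rightarrow> nat list" where
  "ribbon_outer \<alpha> = map (\<lambda>i. sum_list (drop i \<alpha>) - (length \<alpha> - 1 - i)) [0 ..< length \<alpha>]"

definition ribbon_inner :: "nat list \<Rightarrow> nat list" where
  "ribbon_inner \<alpha> = map (\<lambda>i. sum_list (drop (Suc i) \<alpha>) - (length \<alpha> - 1 - i)) [0 ..< length \<alpha>]"

definition ribbon_support :: "nat list \<Rightarrow> nat list set" where
  "ribbon_support \<alpha> = schur_support (ribbon_outer \<alpha>) (ribbon_inner \<alpha>)"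

text \<open>alpha_(i i+1) for 1-indexed i: swap entries i and i+1 (list positions i-1 and i).\<close>
definition swap_adj :: "nat list \<Rightarrow> nat \<Rightarrow> nat list" where
  "swap_adj \<alpha> i = \<alpha>[i - 1 := \<alpha> ! i, i := \<alpha> ! (i - 1)]"

end

theory Submission
  imports Defs "HOL-Library.Multiset"
begin

text \<open>
  A Littlewood--Richardson tableau of ribbon shape is a list of row multisets: consecutive rows
  share one column, so column strictness only asks for an element of a row that is smaller than some
  element of the next row, and the Yamanouchi condition bounds the number of entries \<open>k + 1\<close> up to and
  including a row by the number of entries \<open>k\<close> strictly above it.

  Let \<open>u\<close> and \<open>v\<close> be the \<open>i\<close>-th and the next row, \<open>P\<close> the rows above, and \<open>F\<close> the largest
  multiset contained in both \<open>u\<close> and \<open>v - 1\<close> (entrywise). Moving entries of \<open>u - F\<close> down to \<open>v\<close>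
  preserves the Yamanouchi condition, and it settles the claim unless \<open>F = v - 1\<close> as multisets
  and \<open>F\<close> lies weakly below \<open>\<tau>\<close>, the least entry of the row above \<open>u\<close>. In that case, with
  \<open>Y = u - F\<close>, \<open>M\<close> the largest entry of \<open>u\<close> and \<open>z\<close> the least entry of \<open>F\<close>, one replaces \<open>u\<close> by
  \<open>F - z + M\<close> and \<open>v\<close> by \<open>v + Y - M + y\<close>, where \<open>y\<close> is an entry of \<open>P\<close> that is exchanged for \<open>z\<close>.
  The hypothesis on the row lengths says that \<open>Y\<close> is smaller than the row above \<open>u\<close>, and this
  makes such a \<open>y\<close> exist.
\<close>

section \<open>Ballot row lists and multiset preliminaries\<close>

text \<open>Rows are listed from bottom to top.\<close>

fun ballot_rows :: "nat multiset list \<Rightarrow> bool" where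
  "ballot_rows [] \<longleftrightarrow> True"
| "ballot_rows (T # Q) \<longleftrightarrow> ballot_rows Q \<and> 0 \<notin># T \<and>
     (Q \<noteq> [] \<longrightarrow> (\<exists>x\<in>#hd Q. \<exists>y\<in>#T. x < y)) \<and>
     (\<forall>k\<ge>1. count (sum_list Q) (Suc k) + count T (Suc k) \<le> count (sum_list Q) k)"

lemma ballot_rows_count_le:
  "ballot_rows P \<Longrightarrow> 1 \<le> k \<Longrightarrow> count (sum_list P) (Suc k) \<le> count (sum_list P) k"
  by (cases P) (auto intro: trans_le_add1)

text \<open>The rows in \<open>W\<close> see everything above them only through its total content,
  except that the lowest changed row must offer a small entry for the next ascent. Such an entry of
  \<open>v\<close> is still present in \<open>v'\<close>.\<close>

lemma ballot_rows_append:
  assumes "ballot_rows (W @ v # Q)" "ballot_rows (v' # Q')"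
    and "sum_list (v' # Q') = sum_list (v # Q)" and "v \<subseteq># v'"
  shows "ballot_rows (W @ v' # Q')"
  using assms(1)
proof (induction W)
  case Nil
  then show ?case using assms(2) by simp
next
  case (Cons T W)
  have "sum_list (W @ v' # Q') = sum_list (W @ v # Q)" using assms(3) by simp
  moreover have "\<exists>x\<in>#hd (W @ v' # Q'). \<exists>y\<in>#T. x < y"
    using Cons.prems mset_subset_eqD[OF assms(4)] by (cases W) auto
  ultimately show ?case using Cons by simp
qed

lemma count_image_mset_Suc:
  "count (image_mset Suc T) (Suc k) = count T k" "count (image_mset Suc T) 0 = 0"
  by (induction T) auto

text \<open>Truncated subtraction sends both 0 and 1 to 0, hence the restriction to positive
  \<open>k\<close>.\<close>

lemma count_image_mset_pred:
  "0 < k \<Longrightarrow> count (image_mset (\<lambda>x. x - Suc 0) T) k = count T (Suc k)"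
  by (induction T) auto

lemma obtain_min_mset:
  fixes T :: "nat multiset"
  assumes "T \<noteq> {#}"
  obtains x where "x \<in># T" "\<forall>y\<in>#T. x \<le> y"
  using assms by (meson Min_in Min_le finite_set_mset set_mset_eq_empty_iff)

lemma obtain_max_mset:
  fixes T :: "nat multiset"
  assumes "T \<noteq> {#}"
  obtains x where "x \<in># T" "\<forall>y\<in>#T. y \<le> x"
  using assms by (meson Max_in Max_ge finite_set_mset set_mset_eq_empty_iff)

text \<open>Serves to pad the entries that must stay in a row \<open>u\<close> up to a prescribed
  row length; \<open>E\<close> is the part left over to be moved.\<close>

lemma obtain_intermediate_mset:
  assumes "F \<subseteq># u" "size F \<le> n" "n \<le> size u"
  obtains D E where "u = F + D + E" "size (F + D) = n"
proof -
  obtain G where G: "u = F + G" using assms(1) by (auto simp: subset_mset.le_iff_add)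
  obtain xs where xs: "G = mset xs" using ex_mset by metis
  have "u = F + mset (take (n - size F) xs) + mset (drop (n - size F) xs)"
    by (simp add: G xs add.assoc flip: mset_append)
  moreover have "size (F + mset (take (n - size F) xs)) = n"
    using assms G xs by auto
  ultimately show ?thesis using that by blast
qed

section \<open>Exchanging one entry of the rows above\<close>

text \<open>
  An entry \<open>y\<close> with the required slack exists in the bottom row \<open>T\<close>, because \<open>Y\<close> is smaller than
  \<open>T\<close>. Replacing it by \<open>z\<close> can only break the ascent from the row \<open>R\<close> above, and only if \<open>y\<close> is the
  unique maximum of \<open>T\<close>; then the least entry \<open>\<sigma>\<close> of \<open>R\<close> goes to \<open>T\<close> and \<open>z\<close> goes to \<open>R\<close>. This in turn
  fails only if \<open>\<sigma> = z\<close>, where \<open>T\<close> is forced to consist of one \<open>z + 1\<close> and otherwise \<open>z\<close>, so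
  that the exchange can be made further up, with \<open>Y = {z + 1}\<close>.
\<close>

lemma ballot_rows_exchange:
  assumes "ballot_rows P" "P \<noteq> []" "\<forall>T\<in>set P. size T \<ge> 2"
    and "size Y < size (hd P)"
    and "\<tau> \<in># hd P" "\<forall>x\<in>#hd P. \<tau> \<le> x" "1 \<le> z" "z \<le> \<tau>"
    and "\<forall>k\<ge>1. count (sum_list P) (Suc k) + count Y (Suc k) \<le> count (sum_list P) k"
    and "2 \<le> z \<longrightarrow> count (sum_list P) z < count (sum_list P) (z - 1)"
  shows "\<exists>y P'. ballot_rows P' \<and> map size P' = map size P \<and> (\<exists>x\<in>#hd P'. x \<le> \<tau>) \<and> \<tau> \<le> y \<and>
    add_mset y (sum_list P') = add_mset z (sum_list P) \<and>
    count (sum_list P) (Suc y) + count Y (Suc y) < count (sum_list P) y"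
  using assms
proof (induction P arbitrary: Y \<tau> z)
  case Nil
  then show ?case by simp
next
  case (Cons T Q)
  let ?N = "\<lambda>Q. count (sum_list Q :: nat multiset)"
  have T: "\<tau> \<in># T" "\<And>x. x \<in># T \<Longrightarrow> \<tau> \<le> x" "size Y < size T" "2 \<le> size T" "0 \<notin># T"
    using Cons.prems by auto
  have T_count0: "count T x = 0" if "x < \<tau>" for x
    using T(2)[of x] that by (meson count_inI leD)
  have bQ: "ballot_rows Q" and z: "1 \<le> z" "z \<le> \<tau>" using Cons.prems by auto
  have Tk: "?N Q (Suc k) + count T (Suc k) \<le> ?N Q k" if "1 \<le> k" for k
    using Cons.prems that by simp
  have Yk: "?N (T # Q) (Suc k) + count Y (Suc k) \<le> ?N (T # Q) k" if "1 \<le> k" for k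
    using Cons.prems(9) that by blast
  have zlt: "?N (T # Q) z < ?N (T # Q) (z - 1)" if "2 \<le> z"
    using Cons.prems that by simp
  show ?case
  \<comment> \<open>If \<open>z = \<tau>\<close> has the required slack, then \<open>y = z\<close>
    works and no row changes. The failure of this case returns as \<open>Nz\<close> below.\<close>
  proof (cases "z = \<tau> \<and> ?N (T # Q) (Suc \<tau>) + count Y (Suc \<tau>) < ?N (T # Q) \<tau>")
    case True
    then show ?thesis using Cons.prems(1) T by (intro exI[of _ \<tau>] exI[of _ "T # Q"]) auto
  next
    case not_strict: False
    \<comment> \<open>Without slack at any entry of \<open>T\<close>, the bound \<open>Tk\<close>
      would embed \<open>image_mset Suc T\<close> into \<open>Y\<close>, which is too small.\<close>
    have "\<exists>y\<in>#T. ?N (T # Q) (Suc y) + count Y (Suc y) < ?N (T # Q) y"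
    proof (rule ccontr)
      assume contra: "\<not> ?thesis"
      have "count T y \<le> count Y (Suc y)" for y
      proof (cases "y \<in># T")
        case True
        then have "1 \<le> y" using T(5) by (cases y) auto
        moreover have "?N (T # Q) y \<le> ?N (T # Q) (Suc y) + count Y (Suc y)"
          using contra True by (meson not_less)
        ultimately show ?thesis using Tk[of y] by simp
      qed (simp add: not_in_iff)
      then have "count (image_mset Suc T) x \<le> count Y x" for x
        by (cases x) (simp_all add: count_image_mset_Suc)
      then have "size (image_mset Suc T) \<le> size Y"
        by (intro size_mset_mono) (simp add: subseteq_mset_def)
      then show False using T by simp
    qed
    then obtain y where y: "y \<in># T" "?N (T # Q) (Suc y) + count Y (Suc y) < ?N (T # Q) y"
      by blast
    obtain T0 where T0: "T = add_mset y T0" using y(1) by (meson multi_member_split)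
    show ?thesis
    proof (cases "Q = [] \<or> (\<exists>s\<in>#hd Q. \<exists>x\<in>#add_mset z T0. s < x)")
      case True
      have "?N Q (Suc k) + count (add_mset z T0) (Suc k) \<le> ?N Q k" if k: "1 \<le> k" for k
      proof (cases "Suc k = z")
        \<comment> \<open>The new \<open>z\<close> is paid for by the strict inequality
          \<open>zlt\<close>; \<open>T\<close> contributes nothing at \<open>z - 1\<close>, which
          lies below its minimum \<open>\<tau>\<close>.\<close>
        case True
        then show ?thesis using zlt k T_count0[of k] z(2) T0 by (auto split: if_splits)
      next
        case False
        then show ?thesis using Tk[OF k] T0 by (auto split: if_splits)
      qed
      then have "ballot_rows (add_mset z T0 # Q)"
        using bQ True z T T0 by auto
      then show ?thesis
        using y z T(2) T0 by (intro exI[of _ y] exI[of _ "add_mset z T0 # Q"]) auto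
    next
      case False
      then obtain R Q0 where Q: "Q = R # Q0" by (cases Q) auto
      have le: "x \<le> s" if "s \<in># R" "x \<in># add_mset z T0" for s x
        using False Q that by (auto simp: not_less)
      have R: "2 \<le> size R" "0 \<notin># R" "ballot_rows Q0" using Cons.prems Q by auto
      obtain s0 x0 where "s0 \<in># R" "x0 \<in># T" "s0 < x0" using Cons.prems(1) Q by auto
      then have "s0 < y" using le[of s0 x0] T0 by auto
      have "R \<noteq> {#}" using R by auto
      then obtain \<sigma> where \<sigma>: "\<sigma> \<in># R" "\<forall>s\<in>#R. \<sigma> \<le> s"
        by (rule obtain_min_mset)
      have "\<sigma> < y" using \<sigma> \<open>s0 < y\<close> \<open>s0 \<in># R\<close> by auto
      have T0_le: "x \<le> \<sigma>" if "x \<in># T0" for x using le[OF \<sigma>(1)] that by auto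
      have "T0 \<noteq> {#}" using T(4) T0 by auto
      then obtain x1 where "x1 \<in># T0" by auto
      \<comment> \<open>All of \<open>T0\<close> is at most \<open>\<sigma>\<close>, while
        \<open>y\<close> exceeds \<open>\<sigma>\<close>; so \<open>y\<close> is the unique maximum
        and the minimum of \<open>T\<close> survives its removal.\<close>
      then have "\<tau> \<in># T0" using T(1,2) T0 T0_le \<open>\<sigma> < y\<close>
        by (metis dual_order.strict_trans1 insert_noteq_member leD set_mset_add_mset_insert insertE union_single_eq_member insertI2)
      then have "z \<le> \<sigma>" "\<tau> \<le> \<sigma>" using T0_le[OF \<open>\<tau> \<in># T0\<close>] z by auto
      have R_count0: "count R x = 0" if "x < \<sigma>" for x
        using \<sigma>(2) that by (meson count_inI leD)
      have T0_count0: "count T0 x = 0" if "\<sigma> < x" for x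
        using T0_le that by (meson count_inI leD)
      have Rk: "?N Q0 (Suc k) + count R (Suc k) \<le> ?N Q0 k" if "1 \<le> k" for k
        using bQ Q that by simp
      have "1 \<le> \<sigma>" using \<open>z \<le> \<sigma>\<close> z by simp
      obtain R0 where R0: "R = add_mset \<sigma> R0" using \<sigma>(1) by (meson multi_member_split)
      \<comment> \<open>The row bound of \<open>R\<close> at \<open>\<sigma>\<close> compares with
        the rows above \<open>R\<close> only, so the entry \<open>\<sigma>\<close> of
        \<open>R\<close> adds one unit of slack.\<close>
      have R\<sigma>: "?N Q (Suc \<sigma>) + 1 \<le> ?N Q \<sigma>" using Rk[OF \<open>1 \<le> \<sigma>\<close>] Q R0 by simp
      show ?thesis
      proof (cases "z < \<sigma>")
        case True
        have "R0 \<noteq> {#}" using R R0 by auto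
        then obtain x2 where x2: "x2 \<in># R0" by auto
        have "?N Q0 (Suc k) + count (add_mset z R0) (Suc k) \<le> ?N Q0 k" if k: "1 \<le> k" for k
        proof (cases "Suc k = z")
          case True
          then show ?thesis
            using zlt k T_count0[of k] R_count0[of k] R_count0[of z] \<open>z < \<sigma>\<close> z(2) Q R0
            by (auto split: if_splits)
        next
          case False
          then show ?thesis using Rk[OF k] R0 by (auto split: if_splits)
        qed
        \<comment> \<open>If the ascent into \<open>R\<close> ended at the removed
          \<open>\<sigma>\<close>, the remaining entry \<open>x2\<close> can replace it, since
          \<open>\<sigma>\<close> is the least entry.\<close>
        moreover have "\<exists>s\<in>#hd Q0. \<exists>x\<in>#add_mset z R0. s < x" if Q0: "Q0 \<noteq> []"
        proof -
          obtain s x where "s \<in># hd Q0" "x \<in># R" "s < x"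
            using bQ Q0 unfolding Q ballot_rows.simps by blast
          moreover have "\<sigma> \<le> x2" using \<sigma> x2 R0 by auto
          ultimately show ?thesis using x2 R0
            by (metis insert_iff le_trans less_le_trans set_mset_add_mset_insert)
        qed
        ultimately have "ballot_rows (add_mset z R0 # Q0)"
          using R R0 z by auto
        moreover have "?N (add_mset z R0 # Q0) (Suc k) + count (add_mset \<sigma> T0) (Suc k)
            \<le> ?N (add_mset z R0 # Q0) k" if k: "1 \<le> k" for k
        proof -
          have "\<not> (Suc k = z \<and> k = \<sigma>)" using \<open>z < \<sigma>\<close> by auto
          then consider "Suc k = z" "k \<noteq> \<sigma>" | "k = \<sigma>" "Suc k \<noteq> z" | "k \<noteq> \<sigma>" "Suc k \<noteq> z" by blast
          then show ?thesis
          proof cases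
            case 1
            then show ?thesis using zlt k T_count0[of k] z(2) Q R0 T0 \<open>z < \<sigma>\<close> \<open>\<sigma> < y\<close>
              by (auto split: if_splits)
          next
            \<comment> \<open>\<open>R\<close> has lost one \<open>\<sigma>\<close>: the slack
              \<open>R\<sigma>\<close> absorbs this, and \<open>T0\<close> has no entry above
              \<open>\<sigma>\<close>.\<close>
            case 2
            then show ?thesis using R\<sigma> T0_count0[of "Suc k"] Q R0 \<open>z < \<sigma>\<close>
              by (auto split: if_splits)
          next
            case 3
            then show ?thesis using Tk[OF k] Q R0 T0 by (auto split: if_splits)
          qed
        qed
        ultimately have "ballot_rows (add_mset \<sigma> T0 # add_mset z R0 # Q0)"
          using T(5) T0 True by auto
        moreover have "\<exists>x\<in>#add_mset \<sigma> T0. x \<le> \<tau>" using \<open>\<tau> \<in># T0\<close> by auto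
        ultimately show ?thesis
          using y T(2) T0 Q R0 by (intro exI[of _ y] exI[of _ "add_mset \<sigma> T0 # add_mset z R0 # Q0"]) auto
      next
        case False
        then have eq: "\<sigma> = z" "\<tau> = z" using \<open>z \<le> \<sigma>\<close> \<open>\<tau> \<le> \<sigma>\<close> z by auto
        have "x = z" if "x \<in># T0" for x
          using T0_le[OF that] T(2)[of x] that T0 eq by auto
        then have T0z: "T0 = replicate_mset (size T0) z"
          by (metis set_mset_subset_singletonD singleton_iff subsetI)
        have Nz: "?N (T # Q) z \<le> ?N (T # Q) (Suc z) + count Y (Suc z)"
          using not_strict eq by simp
        have cz: "count T0 z = size T0" "\<And>x. x \<noteq> z \<Longrightarrow> count T0 x = 0"
          by (subst T0z, simp)+
        have Ysz: "count Y (Suc z) \<le> size Y" by (simp add: count_le_size)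
        have "z < y" using \<open>\<sigma> < y\<close> eq by simp
        then have ycases: "count T (Suc z) = (if y = Suc z then 1 else 0)" "count T z = size T0"
          using cz T0 by auto
        have "size Y \<le> size T0" using T(3) T0 by simp
        \<comment> \<open>\<open>Nz\<close> bounds a quantity from the other side than
          \<open>R\<sigma>\<close> and the size bounds do, so all these inequalities are
          equalities.\<close>
        have facts: "y = Suc z" "count Y (Suc z) = size Y" "?N Q z = ?N Q (Suc z) + 1"
          using Nz ycases R\<sigma> eq Ysz \<open>size Y \<le> size T0\<close> by (auto split: if_splits)
        \<comment> \<open>The slack of \<open>Q\<close> at \<open>z\<close> is exactly one. Putting
          \<open>{#Suc z#}\<close> for \<open>Y\<close> uses it up, so strictness forces the
          exchanged entry \<open>y'\<close> above \<open>z\<close>. Then neither \<open>T\<close>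
          nor \<open>Y\<close> contains \<open>Suc y'\<close>, and \<open>T\<close> can stay as it
          is.\<close>
        have "\<exists>y' P'. ballot_rows P' \<and> map size P' = map size Q \<and> (\<exists>x\<in>#hd P'. x \<le> z) \<and> z \<le> y' \<and>
          add_mset y' (sum_list P') = add_mset z (sum_list Q) \<and>
          ?N Q (Suc y') + count {#Suc z#} (Suc y') < ?N Q y'"
        proof (rule Cons.IH)
          show "\<forall>k\<ge>1. ?N Q (Suc k) + count {#Suc z#} (Suc k) \<le> ?N Q k"
            using facts(3) ballot_rows_count_le[OF bQ] by auto
          show "2 \<le> z \<longrightarrow> ?N Q z < ?N Q (z - 1)"
            using zlt T_count0[of "z - 1"] eq by auto
        qed (use Cons.prems bQ Q R \<sigma> eq z in auto)
        then obtain y' Q' where IH: "ballot_rows Q'" "map size Q' = map size Q" "\<exists>x\<in>#hd Q'. x \<le> z"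
          "z \<le> y'" "add_mset y' (sum_list Q') = add_mset z (sum_list Q)"
          "?N Q (Suc y') + count {#Suc z#} (Suc y') < ?N Q y'"
          by blast
        have "z \<noteq> y'" using IH(6) facts(3) by auto
        then have "z < y'" using IH(4) by simp
        have cnt: "?N Q' x + (if x = y' then 1 else 0) = ?N Q x + (if x = z then 1 else 0)" for x
          using arg_cong[OF IH(5), of "\<lambda>M. count M x"] by (auto split: if_splits)
        have Ty': "count T (Suc y') = 0" using T0 cz facts(1) \<open>z < y'\<close> by auto
        have "?N Q' (Suc k) + count T (Suc k) \<le> ?N Q' k" if k: "1 \<le> k" for k
        proof -
          have "\<not> (Suc k = z \<and> k = y')" using \<open>z < y'\<close> by auto
          then consider "Suc k = z" "k \<noteq> y'" | "k = y'" "Suc k \<noteq> z" | "k \<noteq> y'" "Suc k \<noteq> z" by blast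
          then show ?thesis
          proof cases
            case 1
            then show ?thesis using zlt k T_count0[of k] eq cnt[of k] cnt[of z] \<open>z < y'\<close>
              by (auto split: if_splits)
          next
            case 2
            then show ?thesis using IH(6) Ty' cnt[of "Suc y'"] cnt[of y'] \<open>z < y'\<close>
              by (auto split: if_splits)
          next
            case 3
            then show ?thesis using Tk[OF k] cnt[of "Suc k"] cnt[of k]
              by (auto split: if_splits)
          qed
        qed
        moreover have "\<exists>x\<in>#hd Q'. \<exists>y\<in>#T. x < y"
          using IH(3) y(1) facts(1) le_imp_less_Suc by blast
        ultimately have "ballot_rows (T # Q')" using IH(1) T(5) by simp
        moreover have "count Y (Suc y') = 0"
        proof (rule ccontr)
          assume "count Y (Suc y') \<noteq> 0"
          then have "{#Suc y'#} + replicate_mset (size Y) (Suc z) \<subseteq># Y"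
            using facts(2) \<open>z < y'\<close> by (auto simp: subseteq_mset_def)
          from size_mset_mono[OF this] show False by simp
        qed
        ultimately show ?thesis
          using T(1) IH(2,4-6) Ty' eq
          by (intro exI[of _ y'] exI[of _ "T # Q'"]) (auto simp flip: union_mset_add_mset_right)
      qed
    qed
  qed
qed

section \<open>Swapping the lengths of two adjacent rows\<close>

text \<open>At each \<open>k\<close>, either \<open>u'\<close> keeps all entries \<open>k\<close> of
  \<open>u\<close>, and the old bound for \<open>v\<close> applies, or it keeps at least as many as
  \<open>v\<close> has entries \<open>Suc k\<close>, and the old bound for \<open>u\<close>
  suffices.\<close>

lemma ballot_rows_shift:
  assumes "ballot_rows (v # u # P)" "u = u' + D"
    and "u \<inter># image_mset (\<lambda>x. x - 1) v \<subseteq># u'"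
    and "P \<noteq> [] \<longrightarrow> (\<exists>x\<in>#hd P. \<exists>y\<in>#u'. x < y)" "\<exists>x\<in>#u'. \<exists>y\<in>#v + D. x < y"
  shows "ballot_rows ((v + D) # u' # P)"
proof -
  let ?N = "count (sum_list P)"
  have uk: "?N (Suc k) + count u (Suc k) \<le> ?N k" if "1 \<le> k" for k
    using assms(1) that by simp
  have vk: "?N (Suc k) + count u (Suc k) + count v (Suc k) \<le> ?N k + count u k" if "1 \<le> k" for k
    using assms(1) that by (auto simp: algebra_simps)
  have "?N (Suc k) + count u' (Suc k) + count (v + D) (Suc k) \<le> ?N k + count u' k"
    if k: "1 \<le> k" for k
  proof -
    have "min (count u k) (count v (Suc k)) \<le> count u' k"
      using mset_subset_eq_count[OF assms(3), of k] k by (simp add: count_image_mset_pred)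
    then show ?thesis using uk[OF k] vk[OF k] assms(2) by (auto simp: min_def split: if_splits)
  qed
  moreover have "?N (Suc k) + count u' (Suc k) \<le> ?N k" if "1 \<le> k" for k
    using uk[OF that] assms(2) by simp
  ultimately show ?thesis
    using assms(1,2,4,5) by (auto simp: algebra_simps)
qed

text \<open>The case \<open>P = []\<close> reflects the convention that the row above the top row is
  infinite. The inclusion of \<open>v\<close> in \<open>v'\<close> is what
  \<open>ballot_rows_append\<close> needs for the rows below.\<close>

lemma ballot_rows_swap:
  assumes bal: "ballot_rows (v # u # P)" and v2: "2 \<le> size v" and "size v < size u"
    and P2: "\<forall>T\<in>set P. size T \<ge> 2" and P_hd: "P = [] \<or> size u < size (hd P) + size v"
  shows "\<exists>v' u' P'. ballot_rows (v' # u' # P') \<and> size u' = size v \<and> size v' = size u \<and>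
    map size P' = map size P \<and> sum_list (v' # u' # P') = sum_list (v # u # P) \<and> v \<subseteq># v'"
proof -
  let ?N = "count (sum_list P)"
  define F where "F = u \<inter># image_mset (\<lambda>x. x - 1) v"
  have nz: "0 \<notin># u" "0 \<notin># v" using bal by auto
  have F_Suc: "Suc x \<in># v" if "x \<in># F" for x
  proof -
    have "x \<in># u" "x \<in># image_mset (\<lambda>x. x - 1) v" using that by (auto simp: F_def)
    moreover from this obtain w where "w \<in># v" "x = w - 1" by auto
    moreover have "x \<noteq> 0" using nz calculation(1) by metis
    ultimately show ?thesis by simp
  qed
  have F_u: "F \<subseteq># u" by (simp add: F_def)
  have "size F \<le> size (image_mset (\<lambda>x. x - 1) v)" unfolding F_def by (intro size_mset_mono) simp
  then have F_v: "size F \<le> size v" by simp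
  have "u \<noteq> {#}" using assms(3) by auto
  then obtain M where M: "M \<in># u" "\<forall>x\<in>#u. x \<le> M" by (rule obtain_max_mset)
  have max_hd: "\<exists>x\<in>#hd P. x < M" if "P \<noteq> []" using bal M that by auto (meson less_le_trans)
  have uk: "?N (Suc k) + count u (Suc k) \<le> ?N k" if "1 \<le> k" for k
    using bal that by simp
  \<comment> \<open>It is enough to name the entries \<open>G\<close> that must stay in
    \<open>u\<close>: those of \<open>F\<close> and witnesses for both ascents. Padding
    \<open>G\<close> to the size of \<open>v\<close> determines what moves down.\<close>
  have shift: ?thesis if G: "F \<subseteq># G" "G \<subseteq># u" "size G \<le> size v"
    "P \<noteq> [] \<longrightarrow> (\<exists>x\<in>#hd P. \<exists>y\<in>#G. x < y)" "\<exists>x\<in>#G. \<exists>y\<in>#v. x < y" for G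
  proof -
    obtain D E where DE: "u = G + D + E" "size (G + D) = size v"
      using obtain_intermediate_mset[OF G(2,3)] assms(3) by auto
    have "ballot_rows ((v + E) # (G + D) # P)"
    proof (rule ballot_rows_shift[OF bal DE(1)])
      show "u \<inter># image_mset (\<lambda>x. x - 1) v \<subseteq># G + D"
        using G(1) unfolding F_def by (meson mset_subset_eq_add_left subset_mset.order_trans)
    qed (use G in auto)
    moreover have "size (v + E) = size u" using DE by simp
    ultimately show ?thesis
      using DE by (intro exI[of _ "v + E"] exI[of _ "G + D"] exI[of _ P]) (auto simp: ac_simps)
  qed
  show ?thesis
  proof (cases "size F < size v")
    case True
    show ?thesis
    proof (cases "F = {#}")
      case True
      obtain m w where mw: "m \<in># u" "w \<in># v" "m < w" using bal by auto
      \<comment> \<open>Here \<open>m\<close> starts the ascent into \<open>v\<close> and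
        \<open>M\<close> ends the one from above. The union \<open>\<union>#\<close> takes maximal
        multiplicities, so one copy is enough if \<open>m = M\<close>.\<close>
      have "{#m#} \<union># {#M#} \<subseteq># u" using mw M by simp
      moreover have "size ({#m#} \<union># {#M#}) \<le> size v"
      proof -
        have "{#m#} \<union># {#M#} \<subseteq># {#m, M#}" by (simp add: subseteq_mset_def)
        from size_mset_mono[OF this] v2 show ?thesis by simp
      qed
      ultimately show ?thesis using mw max_hd True by (intro shift[of "{#m#} \<union># {#M#}"]) auto
    next
      case False
      then obtain x where x: "x \<in># F" by auto
      have "size (F \<union># {#M#}) \<le> size v"
      proof -
        have "F \<union># {#M#} \<subseteq># add_mset M F" by (simp add: subseteq_mset_def)
        from size_mset_mono[OF this] \<open>size F < size v\<close> show ?thesis by simp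
      qed
      then show ?thesis using x F_Suc[OF x] F_u M max_hd
        by (intro shift[of "F \<union># {#M#}"]) auto
    qed
  next
    case False
    then have size_F: "size F = size v" using F_v by simp
    then have "F \<noteq> {#}" using v2 by auto
    then obtain f where f: "f \<in># F" by auto
    show ?thesis
    proof (cases "P = [] \<or> (\<exists>x\<in>#hd P. \<exists>y\<in>#F. x < y)")
      case True
      then show ?thesis using F_u F_v f F_Suc[OF f] by (intro shift[of F]) auto
    next
      case False
      then have P: "P \<noteq> []" and F_le: "\<And>x y. x \<in># hd P \<Longrightarrow> y \<in># F \<Longrightarrow> y \<le> x"
        by (auto simp: not_less)
      obtain Y where u: "u = F + Y" using F_u by (auto simp: subset_mset.le_iff_add)
      have "hd P \<noteq> {#}" using P2 P by (metis hd_in_set not_numeral_le_zero size_empty)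
      then obtain \<tau> where \<tau>: "\<tau> \<in># hd P" "\<forall>x\<in>#hd P. \<tau> \<le> x" by (rule obtain_min_mset)
      have F\<tau>: "x \<le> \<tau>" if "x \<in># F" for x using F_le \<tau> that by blast
      have "\<tau> < M" using max_hd P \<tau> by force
      then have "M \<in># Y" using M(1) F\<tau> u by force
      then obtain Y0 where Y0: "Y = add_mset M Y0" by (meson multi_member_split)
      obtain z where z: "z \<in># F" "\<forall>x\<in>#F. z \<le> x" by (rule obtain_min_mset[OF \<open>F \<noteq> {#}\<close>])
      then obtain F0 where F0: "F = add_mset z F0" by (meson multi_member_split)
      have F_count: "count F k = count v (Suc k)" if "1 \<le> k" for k
      proof -
        have "F \<subseteq># image_mset (\<lambda>x. x - 1) v" by (simp add: F_def)
        then have "F = image_mset (\<lambda>x. x - 1) v" using size_F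
          by (metis less_irrefl mset_subset_size size_image_mset subset_mset.le_imp_less_or_eq)
        then show ?thesis using that by (simp add: count_image_mset_pred)
      qed
      have z1: "1 \<le> z" using z(1) u nz by (cases z) auto
      \<comment> \<open>\<open>Y\<close> has \<open>size u - size v\<close> elements, so
        \<open>P_hd\<close> is the size condition of the exchange. The slack at \<open>z - 1\<close>
        comes from the entry \<open>z\<close> of \<open>u\<close>.\<close>
      have "\<exists>y P'. ballot_rows P' \<and> map size P' = map size P \<and> (\<exists>x\<in>#hd P'. x \<le> \<tau>) \<and> \<tau> \<le> y \<and>
        add_mset y (sum_list P') = add_mset z (sum_list P) \<and> ?N (Suc y) + count Y (Suc y) < ?N y"
      proof (rule ballot_rows_exchange)
        show "size Y < size (hd P)" using P_hd P u size_F by simp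
        show "\<forall>k\<ge>1. ?N (Suc k) + count Y (Suc k) \<le> ?N k" using uk u by fastforce
        show "2 \<le> z \<longrightarrow> ?N z < ?N (z - 1)" using uk[of "z - 1"] u F0 by (cases z) auto
      qed (use bal P P2 \<tau> z1 F\<tau> z in auto)
      then obtain y P' where yP: "ballot_rows P'" "map size P' = map size P" "\<exists>x\<in>#hd P'. x \<le> \<tau>" "\<tau> \<le> y"
        "add_mset y (sum_list P') = add_mset z (sum_list P)" "?N (Suc y) + count Y (Suc y) < ?N y"
        by blast
      let ?N' = "count (sum_list P')"
      have cnt: "?N' x + (if x = y then 1 else 0) = ?N x + (if x = z then 1 else 0)" for x
        using arg_cong[OF yP(5), of "\<lambda>A. count A x"] by (auto split: if_splits)
      have F_y: "count F (Suc y) = 0" using F\<tau> yP(4) by (meson count_inI not_less_eq_eq)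
      have u'k: "?N' (Suc k) + count (add_mset M F0) (Suc k) \<le> ?N' k" if k: "1 \<le> k" for k
      proof (cases "k = y")
        case True
        then show ?thesis using yP(6) F_y F0 Y0 cnt[of y] cnt[of "Suc y"]
          by (auto split: if_splits)
      next
        case False
        then show ?thesis using uk[OF k] u F0 Y0 cnt[of k] cnt[of "Suc k"]
          by (auto split: if_splits)
      qed
      \<comment> \<open>By \<open>F_count\<close> the entries \<open>Suc k\<close> of
        \<open>v\<close> cancel against the entries \<open>k\<close> of \<open>F\<close>, which
        leaves the bound \<open>uk\<close>. At \<open>k = y\<close> the lost \<open>y\<close> is
        covered by the strict inequality \<open>yP(6)\<close>.\<close>
      have v'k: "?N' (Suc k) + count (add_mset M F0) (Suc k) + count (v + add_mset y Y0) (Suc k)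
        \<le> ?N' k + count (add_mset M F0) k" if k: "1 \<le> k" for k
      proof (cases "k = y")
        case True
        then show ?thesis using yP(6) F_y F0 Y0 cnt[of y] cnt[of "Suc y"] F_count[OF k]
          by (auto split: if_splits)
      next
        case False
        then show ?thesis using uk[OF k] u F0 Y0 cnt[of k] cnt[of "Suc k"] F_count[OF k]
          by (auto split: if_splits)
      qed
      have "\<exists>x\<in>#hd P'. \<exists>y\<in>#add_mset M F0. x < y" using yP(3) \<open>\<tau> < M\<close>
        by (meson le_less_trans union_single_eq_member)
      moreover have "\<exists>x\<in>#add_mset M F0. \<exists>y\<in>#v + add_mset y Y0. x < y"
      proof -
        have "F0 \<noteq> {#}" using size_F v2 F0 by auto
        then obtain x where "x \<in># F0" by auto
        then show ?thesis using F_Suc[of x] F0 by auto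
      qed
      moreover have "0 \<notin># add_mset M F0" "0 \<notin># v + add_mset y Y0"
        using nz u F0 Y0 M \<tau> yP(4) z1 F\<tau>[OF z(1)] by auto
      moreover have "count (sum_list (add_mset M F0 # P')) (Suc k) + count (v + add_mset y Y0) (Suc k)
        \<le> count (sum_list (add_mset M F0 # P')) k" if "1 \<le> k" for k
        using v'k[OF that] by (simp only: sum_list.Cons count_union)
      ultimately have "ballot_rows ((v + add_mset y Y0) # add_mset M F0 # P')"
        using yP(1) u'k unfolding ballot_rows.simps list.sel by blast
      moreover have "sum_list ((v + add_mset y Y0) # add_mset M F0 # P') = sum_list (v # u # P)"
      proof (rule multiset_eqI)
        show "count (sum_list ((v + add_mset y Y0) # add_mset M F0 # P')) x =
          count (sum_list (v # u # P)) x" for x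
          using cnt[of x] u F0 Y0 by (auto split: if_splits)
      qed
      moreover have "size (add_mset M F0) = size v" "size (v + add_mset y Y0) = size u"
        using size_F F0 u Y0 by auto
      ultimately show ?thesis using yP(2)
        by (intro exI[of _ "v + add_mset y Y0"] exI[of _ "add_mset M F0"] exI[of _ P']) auto
    qed
  qed
qed

section \<open>Yamanouchi words made of decreasing rows\<close>

text \<open>In \<open>r\<close> every \<open>Suc k\<close> precedes every \<open>k\<close>, so the
  critical prefix for \<open>k\<close> stops just before the entries at most \<open>k\<close>: it
  contains all \<open>Suc k\<close> of \<open>r\<close> and no \<open>k\<close> of
  \<open>r\<close>.\<close>

lemma yamanouchi_append_decreasing:
  assumes "sorted_wrt (\<ge>) r"
  shows "yamanouchi (w @ r) \<longleftrightarrow> yamanouchi w \<and>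
    (\<forall>k\<ge>1. count_list w (Suc k) + count_list r (Suc k) \<le> count_list w k)"
proof (intro iffI conjI allI impI)
  assume L: "yamanouchi (w @ r)"
  show "yamanouchi w"
    unfolding yamanouchi_def
  proof (intro allI impI)
    fix n k :: nat
    assume "n \<le> length w" "1 \<le> k"
    then show "count_list (take n w) (Suc k) \<le> count_list (take n w) k"
      using L[unfolded yamanouchi_def, rule_format, of n k] by simp
  qed
  fix k :: nat
  assume k: "1 \<le> k"
  let ?p = "takeWhile (\<lambda>x. k < x) r"
  have "take (length w + length ?p) (w @ r) = w @ ?p"
    by (simp flip: takeWhile_eq_take)
  moreover have "length w + length ?p \<le> length (w @ r)" by (simp add: length_takeWhile_le)
  ultimately have "count_list (w @ ?p) (Suc k) \<le> count_list (w @ ?p) k"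
    using L k unfolding yamanouchi_def by metis
  moreover have "count_list ?p k = 0" by (auto simp: count_list_0_iff dest: set_takeWhileD)
  moreover have "count_list ?p (Suc k) = count_list r (Suc k)"
    using assms
  proof (induction r)
    case (Cons a r)
    then show ?case by (auto simp: count_list_0_iff)
  qed simp
  ultimately show "count_list w (Suc k) + count_list r (Suc k) \<le> count_list w k" by simp
next
  assume R: "yamanouchi w \<and>
    (\<forall>k\<ge>1. count_list w (Suc k) + count_list r (Suc k) \<le> count_list w k)"
  show "yamanouchi (w @ r)"
    unfolding yamanouchi_def
  proof (intro allI impI)
    fix n k :: nat
    assume "n \<le> length (w @ r)" and k: "1 \<le> k"
    show "count_list (take n (w @ r)) (Suc k) \<le> count_list (take n (w @ r)) k"
    proof (cases "n \<le> length w")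
      case True
      then show ?thesis using R k unfolding yamanouchi_def by simp
    next
      case False
      have "count_list (take (n - length w) r) (Suc k) + count_list (drop (n - length w) r) (Suc k)
        = count_list r (Suc k)"
        by (metis append_take_drop_id count_list_append)
      moreover have "count_list w (Suc k) + count_list r (Suc k) \<le> count_list w k" using R k by blast
      ultimately show ?thesis using False by simp
    qed
  qed
qed

lemma decreasing_hd_last:
  fixes w :: "nat list"
  assumes "sorted_wrt (\<ge>) w" "x \<in> set w"
  shows "x \<le> hd w" "last w \<le> x"
proof -
  show "x \<le> hd w" using assms by (cases w) auto
  have "w \<noteq> []" using assms(2) by auto
  then have "sorted_wrt (\<ge>) (butlast w @ [last w])" "set w = insert (last w) (set (butlast w))"
    using assms(1) by (simp, metis append_butlast_last_id list.simps(15) rotate1.simps(2) set_rotate1)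
  then show "last w \<le> x" using assms(2) by (auto simp: sorted_wrt_append)
qed

text \<open>A decreasing row has its greatest entry first and its least entry last, so an ascent
  between two multisets exists iff these two extremes form one.\<close>

lemma ballot_rows_rev_mset_iff:
  fixes ws :: "nat list list"
  assumes "\<forall>w\<in>set ws. sorted_wrt (\<ge>) w \<and> w \<noteq> []"
  shows "ballot_rows (rev (map mset ws)) \<longleftrightarrow> yamanouchi (concat ws) \<and> 0 \<notin> set (concat ws) \<and>
    (\<forall>j. Suc j < length ws \<longrightarrow> last (ws ! j) < hd (ws ! Suc j))"
  using assms
proof (induction ws rule: rev_induct)
  case Nil
  then show ?case by (simp add: yamanouchi_def)
next
  case (snoc w ws)
  have sum: "sum_list (map mset ws) = mset (concat ws)" by (simp add: mset_concat)
  have ascent: "(\<exists>x\<in>#hd (rev (map mset ws)). \<exists>y\<in>#mset w. x < y) \<longleftrightarrow> last (last ws) < hd w"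
    if "ws \<noteq> []"
  proof -
    have hd: "hd (rev (map mset ws)) = mset (last ws)" using that by (simp add: hd_rev last_map)
    have s: "sorted_wrt (\<ge>) (last ws)" "last ws \<noteq> []" "sorted_wrt (\<ge>) w" "w \<noteq> []"
      using snoc.prems that by auto
    show ?thesis
      unfolding hd set_mset_mset
      using decreasing_hd_last[OF s(1)] decreasing_hd_last[OF s(3)] s(2,4)
      by (meson hd_in_set last_in_set le_less_trans less_le_trans)
  qed
  have all: "(\<forall>j. Suc j < length (ws @ [w]) \<longrightarrow> last ((ws @ [w]) ! j) < hd ((ws @ [w]) ! Suc j)) \<longleftrightarrow>
    (\<forall>j. Suc j < length ws \<longrightarrow> last (ws ! j) < hd (ws ! Suc j)) \<and>
    (ws \<noteq> [] \<longrightarrow> last (last ws) < hd w)"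
    (is "?L \<longleftrightarrow> ?R")
  proof
    assume L: ?L
    show ?R
    proof (intro conjI allI impI)
      fix j assume "Suc j < length ws"
      then show "last (ws ! j) < hd (ws ! Suc j)" using L[rule_format, of j] by (simp add: nth_append)
    next
      assume "ws \<noteq> []"
      then show "last (last ws) < hd w" using L[rule_format, of "length ws - 1"]
        by (simp add: nth_append last_conv_nth)
    qed
  next
    assume R: ?R
    show ?L
    proof (intro allI impI)
      fix j assume "Suc j < length (ws @ [w])"
      then consider "Suc j < length ws" | "Suc j = length ws" by fastforce
      then show "last ((ws @ [w]) ! j) < hd ((ws @ [w]) ! Suc j)"
      proof cases
        case 1
        then show ?thesis using R by (simp add: nth_append)
      next
        case 2
        then have "ws \<noteq> []" "j = length ws - 1" by auto
        then show ?thesis using R 2 by (simp add: nth_append last_conv_nth)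
      qed
    qed
  qed
  have IH: "ballot_rows (rev (map mset ws)) \<longleftrightarrow> yamanouchi (concat ws) \<and> 0 \<notin> set (concat ws) \<and>
    (\<forall>j. Suc j < length ws \<longrightarrow> last (ws ! j) < hd (ws ! Suc j))"
    using snoc by simp
  have yam: "yamanouchi (concat (ws @ [w])) \<longleftrightarrow> yamanouchi (concat ws) \<and> (\<forall>k\<ge>1.
      count_list (concat ws) (Suc k) + count_list w (Suc k) \<le> count_list (concat ws) k)"
    using yamanouchi_append_decreasing[of w "concat ws"] snoc.prems by simp
  have step: "ballot_rows (rev (map mset (ws @ [w]))) \<longleftrightarrow> ballot_rows (rev (map mset ws)) \<and> 0 \<notin> set w \<and>
    (ws \<noteq> [] \<longrightarrow> last (last ws) < hd w) \<and> (\<forall>k\<ge>1.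
      count_list (concat ws) (Suc k) + count_list w (Suc k) \<le> count_list (concat ws) k)"
    using ascent by (auto simp: sum count_mset)
  show ?case unfolding step all yam IH by auto
qed

section \<open>Ribbon geometry and tableau rows\<close>

text \<open>The auxiliary bound \<open>lower\<close> shows that no subtraction in the ribbon
  definitions is truncated. The last item restricts column strictness to adjacent rows.\<close>

lemma ribbon_shape:
  assumes "\<forall>k < length \<beta>. \<beta> ! k \<ge> 2"
  shows "length (ribbon_outer \<beta>) = length \<beta>"
    and "r < length \<beta> \<Longrightarrow> part_at (ribbon_inner \<beta>) r = ribbon_inner \<beta> ! r"
    and "r < length \<beta> \<Longrightarrow> ribbon_outer \<beta> ! r = ribbon_inner \<beta> ! r + \<beta> ! r"
    and "Suc r < length \<beta> \<Longrightarrow> ribbon_outer \<beta> ! Suc r = Suc (ribbon_inner \<beta> ! r)"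
    and "Suc r < r' \<Longrightarrow> r' < length \<beta> \<Longrightarrow> ribbon_outer \<beta> ! r' \<le> ribbon_inner \<beta> ! r"
proof -
  let ?m = "length \<beta>" and ?S = "\<lambda>i. sum_list (drop i \<beta>)"
  have S: "?S i = \<beta> ! i + ?S (Suc i)" if "i < ?m" for i
    using that by (metis Cons_nth_drop_Suc sum_list.Cons)
  have lower: "?m - i \<le> ?S i" if "i \<le> ?m" for i
    using that
  proof (induction rule: inc_induct)
    case (step n)
    then have "2 \<le> \<beta> ! n" using assms by simp
    then show ?case using S[of n] step by linarith
  qed simp
  show "length (ribbon_outer \<beta>) = length \<beta>" by (simp add: ribbon_outer_def)
  show "r < ?m \<Longrightarrow> part_at (ribbon_inner \<beta>) r = ribbon_inner \<beta> ! r"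
    by (simp add: part_at_def ribbon_inner_def)
  show outer: "ribbon_outer \<beta> ! r = ribbon_inner \<beta> ! r + \<beta> ! r" if "r < ?m" for r
    using that S[of r] lower[of "Suc r"] by (simp add: ribbon_outer_def ribbon_inner_def)
  show next_row: "ribbon_outer \<beta> ! Suc r = Suc (ribbon_inner \<beta> ! r)" if "Suc r < ?m" for r
    using that lower[of "Suc r"] by (simp add: ribbon_outer_def ribbon_inner_def)
  show "ribbon_outer \<beta> ! r' \<le> ribbon_inner \<beta> ! r" if "Suc r < r'" "r' < ?m"
    using Suc_leI[OF that(1)] that(2)
  proof (induction r' rule: dec_induct)
    case base
    then show ?case using outer[of "Suc r"] next_row[of r] next_row[of "Suc r"] assms[rule_format, of "Suc r"]
      by simp
  next
    case (step n)
    then show ?case using outer[of n] next_row[of n] assms[rule_format, of n]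
      by simp
  qed
qed

lemma sorted_wrt_map_rev_upt:
  "sorted_wrt (\<ge>) (map f (rev [a..<b])) \<longleftrightarrow>
    (\<forall>c c'. a \<le> c \<longrightarrow> c' < b \<longrightarrow> c < c' \<longrightarrow> f c \<le> (f c' :: nat))"
proof -
  have "sorted_wrt (\<ge>) (map f (rev [a..<b])) \<longleftrightarrow> sorted_wrt (\<lambda>x y. f x \<le> f y) [a..<b]"
    by (simp add: sorted_wrt_map sorted_wrt_rev flip: rev_map)
  also have "\<dots> \<longleftrightarrow> (\<forall>c c'. a \<le> c \<longrightarrow> c' < b \<longrightarrow> c < c' \<longrightarrow> f c \<le> f c')"
    by (induction b) (auto simp: sorted_wrt_append less_Suc_eq)
  finally show ?thesis .
qed

text \<open>Listing the cells themselves in reading order turns cell cardinalities into letter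
  counts of the word.\<close>

lemma obtain_reading_order:
  obtains cs where "distinct cs" "set cs = skew_cells la mu" "reverse_reading_word la mu T = map T cs"
proof
  let ?row = "\<lambda>r. map (Pair r) (rev [part_at mu r..<la ! r])"
  have "distinct (concat (map ?row [0..<n]))" for n
    by (induction n) (auto simp: distinct_map inj_on_def)
  then show "distinct (concat (map ?row [0..<length la]))" .
  show "set (concat (map ?row [0..<length la])) = skew_cells la mu"
    by (auto simp: skew_cells_def image_iff Bex_def)
  show "reverse_reading_word la mu T = map T (concat (map ?row [0..<length la]))"
    by (simp add: reverse_reading_word_def map_concat o_def)
qed

lemma card_skew_cells_eq_count_list:
  "card {x \<in> skew_cells la mu. T x = v} = count_list (reverse_reading_word la mu T) v"
proof -
  obtain cs where cs: "distinct cs" "set cs = skew_cells la mu" "reverse_reading_word la mu T = map T cs"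
    by (rule obtain_reading_order)
  have "{x \<in> skew_cells la mu. T x = v} = set (filter ((=) v \<circ> T) cs)" using cs(2) by auto
  then have "card {x \<in> skew_cells la mu. T x = v} = length (filter ((=) v \<circ> T) cs)"
    using distinct_card[OF distinct_filter[OF cs(1)]] by metis
  then show ?thesis by (simp add: cs(3) count_list_eq_length_filter filter_map)
qed

lemma set_reverse_reading_word: "set (reverse_reading_word la mu T) = T ` skew_cells la mu"
  by (rule obtain_reading_order[of la mu T]) simp

definition ribbon_rows :: "nat list \<Rightarrow> (nat \<times> nat \<Rightarrow> nat) \<Rightarrow> nat list list" where
  "ribbon_rows \<beta> T = map (\<lambda>r. map (\<lambda>c. T (r, c)) (rev [ribbon_inner \<beta> ! r..<ribbon_outer \<beta> ! r]))
     [0..<length \<beta>]"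

lemma ribbon_rows_simps:
  assumes "\<forall>k < length \<beta>. \<beta> ! k \<ge> 2"
  shows "map length (ribbon_rows \<beta> T) = \<beta>"
    and "concat (ribbon_rows \<beta> T) = reverse_reading_word (ribbon_outer \<beta>) (ribbon_inner \<beta>) T"
proof -
  note shape = ribbon_shape[OF assms]
  show "map length (ribbon_rows \<beta> T) = \<beta>"
    by (rule nth_equalityI) (auto simp: ribbon_rows_def shape)
  show "concat (ribbon_rows \<beta> T) = reverse_reading_word (ribbon_outer \<beta>) (ribbon_inner \<beta>) T"
    by (auto simp: ribbon_rows_def reverse_reading_word_def shape intro!: arg_cong[where f=concat])
qed

text \<open>Adjacent rows share only the column \<open>ribbon_inner \<beta> ! j\<close>, which holds
  the leftmost cell of row \<open>j\<close>, read last, and the rightmost cell of the next row, read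
  first.\<close>

lemma semistandard_ribbon_iff:
  assumes "\<forall>k < length \<beta>. \<beta> ! k \<ge> 2"
  shows "semistandard (ribbon_outer \<beta>) (ribbon_inner \<beta>) T \<longleftrightarrow>
    (\<forall>w\<in>set (ribbon_rows \<beta> T). sorted_wrt (\<ge>) w) \<and>
    (\<forall>j. Suc j < length \<beta> \<longrightarrow> last (ribbon_rows \<beta> T ! j) < hd (ribbon_rows \<beta> T ! Suc j))"
proof -
  note shape = ribbon_shape[OF assms]
  let ?o = "ribbon_outer \<beta>" and ?n = "ribbon_inner \<beta>"
  have cells: "(r, c) \<in> skew_cells ?o ?n \<longleftrightarrow> r < length \<beta> \<and> ?n ! r \<le> c \<and> c < ?o ! r" for r c
    by (auto simp: skew_cells_def shape)
  have nonempty: "?n ! r < ?o ! r" if "r < length \<beta>" for r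
    using shape(3)[OF that] assms that by (metis less_add_same_cancel1 not_gr0 not_numeral_le_zero)
  have last_row: "last (ribbon_rows \<beta> T ! j) = T (j, ?n ! j)" if "j < length \<beta>" for j
    using that nonempty[OF that] by (simp add: ribbon_rows_def last_map last_rev hd_upt)
  have hd_row: "hd (ribbon_rows \<beta> T ! Suc j) = T (Suc j, ?n ! j)" if "Suc j < length \<beta>" for j
    using that nonempty[OF that] shape(4)[OF that] by (simp add: ribbon_rows_def hd_map hd_rev)
  have rows: "(\<forall>r c c'. (r, c) \<in> skew_cells ?o ?n \<longrightarrow> (r, c') \<in> skew_cells ?o ?n \<longrightarrow> c < c' \<longrightarrow>
      T (r, c) \<le> T (r, c')) \<longleftrightarrow> (\<forall>w\<in>set (ribbon_rows \<beta> T). sorted_wrt (\<ge>) w)"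
    unfolding cells ribbon_rows_def by (auto simp: sorted_wrt_map_rev_upt)
  have columns: "(\<forall>r r' c. (r, c) \<in> skew_cells ?o ?n \<longrightarrow> (r', c) \<in> skew_cells ?o ?n \<longrightarrow> r < r' \<longrightarrow>
      T (r, c) < T (r', c)) \<longleftrightarrow>
      (\<forall>j. Suc j < length \<beta> \<longrightarrow> last (ribbon_rows \<beta> T ! j) < hd (ribbon_rows \<beta> T ! Suc j))"
    (is "?L \<longleftrightarrow> ?R")
  proof
    assume L: ?L
    show ?R
    proof (intro allI impI)
      fix j assume j: "Suc j < length \<beta>"
      have "(j, ?n ! j) \<in> skew_cells ?o ?n" "(Suc j, ?n ! j) \<in> skew_cells ?o ?n"
        unfolding cells using j nonempty[of j] nonempty[of "Suc j"] shape(4)[OF j] by auto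
      then show "last (ribbon_rows \<beta> T ! j) < hd (ribbon_rows \<beta> T ! Suc j)"
        using L last_row[of j] hd_row[of j] j by auto
    qed
  next
    assume R: ?R
    show ?L
    proof (intro allI impI)
      fix r r' c
      assume A: "(r, c) \<in> skew_cells ?o ?n" "(r', c) \<in> skew_cells ?o ?n" "r < r'"
      then have "\<not> Suc r < r'" using shape(5)[of r r'] by (auto simp: cells)
      then have "r' = Suc r" using A(3) by simp
      moreover from this have "c = ?n ! r" using A shape(4)[of r] by (auto simp: cells)
      ultimately show "T (r, c) < T (r', c)"
        using R last_row[of r] hd_row[of r] A by (auto simp: cells)
    qed
  qed
  show ?thesis unfolding semistandard_def rows columns by blast
qed

lemma ribbon_rows_surj:
  assumes "\<forall>k < length \<beta>. \<beta> ! k \<ge> 2" "map length ws = \<beta>"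
  obtains T where "ribbon_rows \<beta> T = ws"
proof
  note shape = ribbon_shape[OF assms(1)]
  \<comment> \<open>\<open>rev\<close> undoes the right-to-left reading, so the index is the
    distance from the left end of the row.\<close>
  let ?T = "\<lambda>(r, c). rev (ws ! r) ! (c - ribbon_inner \<beta> ! r)"
  show "ribbon_rows \<beta> ?T = ws"
  proof (rule nth_equalityI)
    fix r assume "r < length (ribbon_rows \<beta> ?T)"
    then have r: "r < length \<beta>" "length (ws ! r) = \<beta> ! r"
      using assms(2) by (auto simp: ribbon_rows_def)
    have "map (\<lambda>c. ?T (r, c)) [ribbon_inner \<beta> ! r..<ribbon_outer \<beta> ! r] = rev (ws ! r)"
      by (rule nth_equalityI) (use r in \<open>auto simp: shape\<close>)
    then show "ribbon_rows \<beta> ?T ! r = ws ! r"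
      using r by (simp add: ribbon_rows_def flip: rev_map)
  qed (use assms(2) in \<open>auto simp: ribbon_rows_def\<close>)
qed

section \<open>Schur support in terms of ballot rows, and the conclusion\<close>

text \<open>A weakly increasing row is determined by its multiset of entries, so a tableau can be
  replaced by its row multisets, listed from the bottom and hence of sizes
  \<open>rev \<beta>\<close>.\<close>

lemma ribbon_support_iff_ballot_rows:
  assumes "\<forall>k < length \<beta>. \<beta> ! k \<ge> 2"
  shows "\<nu> \<in> ribbon_support \<beta> \<longleftrightarrow> is_partition \<nu> \<and> (\<exists>R. ballot_rows R \<and> map size R = rev \<beta> \<and>
    set_mset (sum_list R) \<subseteq> {1..length \<nu>} \<and> (\<forall>k<length \<nu>. count (sum_list R) (Suc k) = \<nu> ! k))"
proof -
  have lr: "lr_tableau (ribbon_outer \<beta>) (ribbon_inner \<beta>) \<nu> T \<longleftrightarrow>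
    (\<forall>w\<in>set (ribbon_rows \<beta> T). sorted_wrt (\<ge>) w) \<and>
    ballot_rows (rev (map mset (ribbon_rows \<beta> T))) \<and>
    set (concat (ribbon_rows \<beta> T)) \<subseteq> {1..length \<nu>} \<and>
    (\<forall>k<length \<nu>. count_list (concat (ribbon_rows \<beta> T)) (Suc k) = \<nu> ! k)" for T
  proof -
    let ?ws = "ribbon_rows \<beta> T"
    have len: "length ?ws = length \<beta>" by (simp add: ribbon_rows_def)
    have "length w \<noteq> 0" if w: "w \<in> set ?ws" for w
    proof -
      have "length w \<in> set \<beta>" using w ribbon_rows_simps(1)[OF assms, of T] by (metis image_eqI list.set_map)
      then show ?thesis using assms by (metis in_set_conv_nth not_numeral_le_zero)
    qed
    then have nonempty: "\<forall>w\<in>set ?ws. w \<noteq> []" by auto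
    have content: "(\<forall>x\<in>skew_cells (ribbon_outer \<beta>) (ribbon_inner \<beta>). 1 \<le> T x \<and> T x \<le> length \<nu>) \<longleftrightarrow>
      set (concat ?ws) \<subseteq> {1..length \<nu>}"
      unfolding ribbon_rows_simps(2)[OF assms] set_reverse_reading_word by auto
    show ?thesis
      using nonempty ballot_rows_rev_mset_iff[of ?ws]
      unfolding lr_tableau_def content card_skew_cells_eq_count_list
        semistandard_ribbon_iff[OF assms] ribbon_rows_simps(2)[OF assms, symmetric]
      by (auto simp: len)
  qed
  show ?thesis
    unfolding ribbon_support_def schur_support_def mem_Collect_eq
  proof (intro conj_cong refl iffI; elim exE conjE)
    fix T
    assume "lr_tableau (ribbon_outer \<beta>) (ribbon_inner \<beta>) \<nu> T"
    then have T: "ballot_rows (rev (map mset (ribbon_rows \<beta> T)))"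
      "set (concat (ribbon_rows \<beta> T)) \<subseteq> {1..length \<nu>}"
      "\<forall>k<length \<nu>. count_list (concat (ribbon_rows \<beta> T)) (Suc k) = \<nu> ! k"
      unfolding lr by blast+
    let ?R = "rev (map mset (ribbon_rows \<beta> T))"
    have sum: "sum_list (map mset (ribbon_rows \<beta> T)) = mset (concat (ribbon_rows \<beta> T))"
      by (simp add: mset_concat)
    have "map size ?R = rev (map length (ribbon_rows \<beta> T))" by (simp add: rev_map o_def)
    also have "\<dots> = rev \<beta>" by (simp add: ribbon_rows_simps(1)[OF assms])
    finally show "\<exists>R. ballot_rows R \<and> map size R = rev \<beta> \<and> set_mset (sum_list R) \<subseteq> {1..length \<nu>} \<and>
        (\<forall>k<length \<nu>. count (sum_list R) (Suc k) = \<nu> ! k)"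
      using T by (intro exI[of _ ?R]) (simp add: sum count_mset)
  next
    fix R
    assume R: "ballot_rows R" "map size R = rev \<beta>" "set_mset (sum_list R) \<subseteq> {1..length \<nu>}"
      "\<forall>k<length \<nu>. count (sum_list R) (Suc k) = \<nu> ! k"
    let ?ws = "map (rev \<circ> sorted_list_of_multiset) (rev R)"
    have ws: "rev (map mset ?ws) = R" by (simp add: rev_map o_def)
    have "map length ?ws = rev (map size R)"
      by (simp add: rev_map o_def flip: size_mset)
    then have "map length ?ws = \<beta>" using R(2) by simp
    then obtain T where T: "ribbon_rows \<beta> T = ?ws" using ribbon_rows_surj[OF assms] by blast
    have "\<forall>w\<in>set ?ws. sorted_wrt (\<ge>) w"
      by (auto simp: sorted_wrt_rev)
    moreover have sum: "mset (concat ?ws) = sum_list R"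
      using ws by (metis mset_concat sum_list_rev)
    have "set (concat ?ws) \<subseteq> {1..length \<nu>}" using R(3) sum by (metis set_mset_mset)
    moreover have "\<forall>k<length \<nu>. count_list (concat ?ws) (Suc k) = \<nu> ! k"
      using R(4) sum by (metis count_mset)
    ultimately have "lr_tableau (ribbon_outer \<beta>) (ribbon_inner \<beta>) \<nu> T"
      unfolding lr T ws using R(1) by blast
    then show "\<exists>T. lr_tableau (ribbon_outer \<beta>) (ribbon_inner \<beta>) \<nu> T" by blast
  qed
qed

theorem theorem3p3:
  fixes \<alpha> :: "nat list" and i :: nat
  assumes "length \<alpha> \<ge> 3"
    and "\<forall>k < length \<alpha>. \<alpha> ! k \<ge> 2"
    and "1 \<le> i" and "i \<le> length \<alpha> - 1"
    and "\<alpha> ! (i - 1) > \<alpha> ! i"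
    and "i = 1 \<or> \<alpha> ! (i - 1) < \<alpha> ! (i - 2) + \<alpha> ! i"
  shows "ribbon_support \<alpha> \<subseteq> ribbon_support (swap_adj \<alpha> i)"
proof
  fix \<nu> assume "\<nu> \<in> ribbon_support \<alpha>"
  then obtain R where part: "is_partition \<nu>" and R: "ballot_rows R" "map size R = rev \<alpha>"
    "set_mset (sum_list R) \<subseteq> {1..length \<nu>}" "\<forall>k<length \<nu>. count (sum_list R) (Suc k) = \<nu> ! k"
    unfolding ribbon_support_iff_ballot_rows[OF assms(2)] by blast
  \<comment> \<open>The list positions are one less than the indices of the composition: the two
    swapped rows are at \<open>i - 1\<close> and \<open>i\<close>, between \<open>A\<close> and
    \<open>B\<close>.\<close>
  define A B where "A = take (i - 1) \<alpha>" and "B = drop (Suc i) \<alpha>"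
  have i: "Suc (i - 1) = i" "i - 1 < length \<alpha>" "i < length \<alpha>" using assms by auto
  have \<alpha>: "\<alpha> = A @ \<alpha> ! (i - 1) # \<alpha> ! i # B"
    unfolding A_def B_def using i by (metis Cons_nth_drop_Suc append_take_drop_id)
  have len_A: "length A = i - 1" using i by (simp add: A_def)
  have swap: "swap_adj \<alpha> i = A @ \<alpha> ! i # \<alpha> ! (i - 1) # B"
  proof -
    have "(A @ a # b # B)[i - 1 := c, i := d] = A @ c # d # B" for a b c d
      using len_A i(1) by (simp add: list_update_append split: nat.split)
    then show ?thesis unfolding swap_adj_def using \<alpha> by metis
  qed
  have "map size R = rev B @ \<alpha> ! i # \<alpha> ! (i - 1) # rev A"
    using R(2) arg_cong[OF \<alpha>, of rev] by simp
  then obtain W v u P where R_eq: "R = W @ v # u # P" and sizes: "map size W = rev B"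
    "size v = \<alpha> ! i" "size u = \<alpha> ! (i - 1)" "map size P = rev A"
    by (auto simp: map_eq_append_conv map_eq_Cons_conv)
  have ge2: "\<forall>x\<in>set \<alpha>. 2 \<le> x" using assms(2) by (auto simp: in_set_conv_nth)
  have bal: "ballot_rows (v # u # P)"
    using R(1) unfolding R_eq by (induction W) auto
  have "\<exists>v' u' P'. ballot_rows (v' # u' # P') \<and> size u' = size v \<and> size v' = size u \<and>
    map size P' = map size P \<and> sum_list (v' # u' # P') = sum_list (v # u # P) \<and> v \<subseteq># v'"
  proof (rule ballot_rows_swap[OF bal])
    show "2 \<le> size v" using sizes i assms(2) by simp
    show "size v < size u" using sizes assms(5) by simp
    have "size ` set P = set A" using arg_cong[OF sizes(4), of set] by simp
    then show "\<forall>T\<in>set P. 2 \<le> size T" using ge2 by (metis A_def image_eqI in_set_takeD)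
    show "P = [] \<or> size u < size (hd P) + size v"
    proof (cases "i = 1")
      case True
      then show ?thesis using sizes(4) len_A by simp
    next
      case False
      \<comment> \<open>\<open>P\<close> lists the rows of \<open>A\<close> from the bottom, so its
        head is the row directly above \<open>u\<close>, at list position
        \<open>i - 2\<close>.\<close>
      then have "A \<noteq> []" "P \<noteq> []" using len_A sizes(4) assms(3) by auto
      then have "size (hd P) = A ! (i - 2)"
        using sizes(4) len_A by (metis One_nat_def diff_diff_left hd_map hd_rev last_conv_nth one_add_one)
      also have "\<dots> = \<alpha> ! (i - 2)" using False assms(3) by (simp add: A_def)
      finally show ?thesis using assms(6) False sizes by simp
    qed
  qed
  then obtain v' u' P' where new: "ballot_rows (v' # u' # P')" "size u' = size v" "size v' = size u"
    "map size P' = map size P" "sum_list (v' # u' # P') = sum_list (v # u # P)" "v \<subseteq># v'"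
    by blast
  let ?R' = "W @ v' # u' # P'"
  have "ballot_rows ?R'"
    using ballot_rows_append[OF _ new(1,5,6)] R(1) unfolding R_eq by blast
  moreover have "map size ?R' = rev (swap_adj \<alpha> i)"
    using swap sizes new by simp
  moreover have "sum_list ?R' = sum_list R" using new(5) R_eq by simp
  ultimately have "\<exists>R. ballot_rows R \<and> map size R = rev (swap_adj \<alpha> i) \<and>
    set_mset (sum_list R) \<subseteq> {1..length \<nu>} \<and> (\<forall>k<length \<nu>. count (sum_list R) (Suc k) = \<nu> ! k)"
    using R(3,4) by (intro exI[of _ ?R']) (simp only: simp_thms)
  moreover have "\<forall>k < length (swap_adj \<alpha> i). swap_adj \<alpha> i ! k \<ge> 2"
  proof -
    have "set (swap_adj \<alpha> i) = set \<alpha>" using arg_cong[OF \<alpha>, of set] swap by auto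
    then show ?thesis using ge2 nth_mem by metis
  qed
  ultimately show "\<nu> \<in> ribbon_support (swap_adj \<alpha> i)"
    using part by (simp only: ribbon_support_iff_ballot_rows simp_thms)
qed

end
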